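(* Let $(C,\triangle_k)$ be an $A_\infty$-coalgebra and $R:C\to C$ a Rota-Baxter operator (of weight $0$) on it. Then the graded vector space $C$ inherits a $\mathrm{Dend}_\infty$-coalgebra structure with coproducts $$\triangle_{k,[r]}=(R\otimes\cdots\otimes\underbrace{\mathrm{id}}_{r\text{-th place}}\otimes\cdots\otimes R)\circ\triangle_k,\quad\text{for }k\ge1\text{ and }[r]\in C_k.$$
   Context: All vector spaces, linear maps and tensor products are over a field $\mathbb K$ of characteristic zero; graded maps follow the Koszul sign convention. An $A_\infty$-coalgebra is a graded vector space $C=\bigoplus C_i$ with linear maps $\triangle_k:C\to C^{\otimes k}$ of degree $k-2$, $k\ge1$, satisfying for all $n\ge1$ $$\sum_{r+s+t=n,\ r,t\ge0,\ s\ge1}(-1)^{rs+t}(\mathrm{id}^{\otimes r}\otimes\triangle_s\otimes\mathrm{id}^{\otimes t})\circ\triangle_{r+1+t}=0.$$ A Rota-Baxter operator (of weight $0$) on $(C,\triangle_k)$ is a degree $0$ linear map $R:C\to C$ such that for all $k\ge1$ $$R^{\otimes k}\circ\triangle_k=\Big(\sum_{i=1}^kR\otimes\cdots\otimes\underbrace{\mathrm{id}}_{i\text{-th place}}\otimes\cdots\otimes R\Big)\circ\triangle_k\circ R,$$ where in each summand all tensor factors other than the $i$-th are $R$. $C_n=\{[1],\dots,[n]\}$ (a set of labels) and $\mathbb K[C_n]$ is the vector space with basis $C_n$. For $m,n\ge1$, $1\le i\le m$ define $R_0^{m,i,n}:C_{m+n-1}\to C_m$ by $[r]\mapsto[r]$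 if $r\le i-1$, $[r]\mapsto[i]$ if $i\le r\le i+n-1$, $[r]\mapsto[r-n+1]$ if $i+n\le r\le m+n-1$; and $R_1^{m,i,n}:C_{m+n-1}\to\mathbb K[C_n]$ by $[r]\mapsto[r-i+1]$ if $i\le r\le i+n-1$ and $[r]\mapsto[1]+\cdots+[n]$ otherwise. Set $\triangle_{k,[r_1]+\cdots+[r_p]}=\triangle_{k,[r_1]}+\cdots+\triangle_{k,[r_p]}$. A $\mathrm{Dend}_\infty$-coalgebra is a graded vector space $C=\bigoplus C_i$ with graded linear maps $\triangle_{k,[r]}:C\to C^{\otimes k}$ of degree $k-2$, for $[r]\in C_k$, $1\le k<\infty$, satisfying for all $n\ge1$ and $[\theta]\in C_n$ $$\sum_{r+s+t=n,\ r,t\ge0,\ s\ge1}(-1)^{rs+t}(\mathrm{id}^{\otimes r}\otimes\triangle_{s,R_1^{r+1+t,r+1,s}[\theta]}\otimes\mathrm{id}^{\otimes t})\circ\triangle_{r+1+t,R_0^{r+1+t,r+1,s}[\theta]}=0.$$ *)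

theory Defs
  imports Complex_Main "HOL-Library.Function_Algebras" "HOL-Library.Poly_Mapping"
begin

section \<open>Tensor powers of a vector space\<close>

text \<open>
  A vector space over the field \<open>'k\<close> is a type \<open>'a\<close> with a scalar multiplication \<open>scale\<close> satisfying
  \<^locale>\<open>vector_space\<close>. A tensor is realised as a functional on multilinear forms: the pure tensor
  \<open>v\<^sub>1 \<otimes> \<dots> \<otimes> v\<^sub>k\<close> is evaluation at the list \<open>[v\<^sub>1, \<dots>, v\<^sub>k]\<close>, and the \<open>k\<close>-th tensor power is the span
  of the pure tensors of length \<open>k\<close>. The universal property is proved below.
\<close>

type_synonym ('k, 'a) tensor = "('a list \<Rightarrow> 'k) \<Rightarrow> 'k"

definition multilinear ::
  "('k::field \<Rightarrow> 'a::ab_group_add \<Rightarrow> 'a) \<Rightarrow> ('k \<Rightarrow> 'b::ab_group_add \<Rightarrow> 'b) \<Rightarrow> nat \<Rightarrow> ('a list \<Rightarrow> 'b) \<Rightarrow> bool"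
  where "multilinear s1 s2 k f \<longleftrightarrow>
    (\<forall>vs. length vs = k \<longrightarrow> (\<forall>i<k. Vector_Spaces.linear s1 s2 (\<lambda>x. f (vs[i := x]))))"

definition tscale :: "'k::field \<Rightarrow> ('k, 'a) tensor \<Rightarrow> ('k, 'a) tensor"
  where "tscale c \<phi> = (\<lambda>g. c * \<phi> g)"

definition pure_tensor :: "('k::field \<Rightarrow> 'a::ab_group_add \<Rightarrow> 'a) \<Rightarrow> 'a list \<Rightarrow> ('k, 'a) tensor"
  where "pure_tensor scale vs = (\<lambda>g. if multilinear scale (*) (length vs) g then g vs else 0)"

definition tensor_power :: "('k::field \<Rightarrow> 'a::ab_group_add \<Rightarrow> 'a) \<Rightarrow> nat \<Rightarrow> ('k, 'a) tensor set"
  where "tensor_power scale k = module.span tscale {pure_tensor scale vs | vs. length vs = k}"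

text \<open>The linear map on a tensor power induced by a multilinear map \<open>F\<close> with values in tensors.\<close>

definition tensor_lift :: "('a list \<Rightarrow> ('k::field, 'b) tensor) \<Rightarrow> ('k, 'a) tensor \<Rightarrow> ('k, 'b) tensor"
  where "tensor_lift F \<phi> = (\<lambda>g. \<phi> (\<lambda>vs. F vs g))"

text \<open>\<open>f\<^sub>1 \<otimes> \<dots> \<otimes> f\<^sub>k\<close> for degree \<open>0\<close> endomorphisms \<open>f\<^sub>i\<close>, where the Koszul rule produces no signs.\<close>

definition tensor_map ::
  "('k::field \<Rightarrow> 'a::ab_group_add \<Rightarrow> 'a) \<Rightarrow> ('a \<Rightarrow> 'a) list \<Rightarrow> ('k, 'a) tensor \<Rightarrow> ('k, 'a) tensor"
  where "tensor_map scale fs = tensor_lift (\<lambda>vs. pure_tensor scale (map2 (\<lambda>f v. f v) fs vs))"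


section \<open>Graded vector spaces and graded maps\<close>

definition decomposition ::
  "(int \<Rightarrow> 'a::ab_group_add set) \<Rightarrow> 'a \<Rightarrow> (int \<Rightarrow> 'a) \<Rightarrow> bool"
  where "decomposition C v c \<longleftrightarrow>
    (\<forall>i. c i \<in> C i) \<and> finite {i. c i \<noteq> 0} \<and> v = (\<Sum>i | c i \<noteq> 0. c i)"

locale graded_vector_space = vector_space scale
  for scale :: "'k::field_char_0 \<Rightarrow> 'a::ab_group_add \<Rightarrow> 'a" +
  fixes C :: "int \<Rightarrow> 'a set"
  assumes subspace_C: "\<And>i. module.subspace scale (C i)"
    and direct_sum: "\<And>v. \<exists>!c. decomposition C v c"

definition component :: "(int \<Rightarrow> 'a::ab_group_add set) \<Rightarrow> 'a \<Rightarrow> int \<Rightarrow> 'a"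
  where "component C v = (THE c. decomposition C v c)"

text \<open>The linear map that multiplies a homogeneous \<open>v\<close> by \<open>(-1)\<^bsup>p \<bar>v\<bar>\<^esup>\<close>, which is the Koszul sign for
  moving a map of degree \<open>p\<close> past \<open>v\<close>.\<close>

definition koszul_twist ::
  "('k::field \<Rightarrow> 'a::ab_group_add \<Rightarrow> 'a) \<Rightarrow> (int \<Rightarrow> 'a set) \<Rightarrow> int \<Rightarrow> 'a \<Rightarrow> 'a"
  where "koszul_twist scale C p v =
    (\<Sum>i | component C v i \<noteq> 0. scale ((-1) powi (p * i)) (component C v i))"

text \<open>
  \<open>id\<^bsup>\<otimes>r\<^esup> \<otimes> D \<otimes> id\<^bsup>\<otimes>t\<^esup>\<close> for a map \<open>D\<close> of degree \<open>p\<close> into a tensor power: on homogeneous \<open>v\<^sub>i\<close>,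
  \<open>v\<^sub>1 \<otimes> \<dots> \<otimes> v\<^bsub>r+1+t\<^esub>\<close> is sent to
  \<open>(-1)\<^bsup>p(\<bar>v\<^sub>1\<bar> + \<dots> + \<bar>v\<^sub>r\<bar>)\<^esup> v\<^sub>1 \<otimes> \<dots> \<otimes> v\<^sub>r \<otimes> D v\<^bsub>r+1\<^esub> \<otimes> v\<^bsub>r+2\<^esub> \<otimes> \<dots> \<otimes> v\<^bsub>r+1+t\<^esub>\<close>; see lemma
  \<open>tensor_insert_homogeneous\<close>. The number \<open>t\<close> is determined by the argument.
\<close>

definition tensor_between ::
  "('k::field \<Rightarrow> 'a::ab_group_add \<Rightarrow> 'a) \<Rightarrow> 'a list \<Rightarrow> ('k, 'a) tensor \<Rightarrow> 'a list \<Rightarrow> ('k, 'a) tensor"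
  where "tensor_between scale us \<tau> ws = tensor_lift (\<lambda>xs. pure_tensor scale (us @ xs @ ws)) \<tau>"

definition tensor_insert ::
  "('k::field \<Rightarrow> 'a::ab_group_add \<Rightarrow> 'a) \<Rightarrow> (int \<Rightarrow> 'a set) \<Rightarrow> int \<Rightarrow> nat \<Rightarrow> ('a \<Rightarrow> ('k, 'a) tensor) \<Rightarrow>
    ('k, 'a) tensor \<Rightarrow> ('k, 'a) tensor"
  where "tensor_insert scale C p r D = tensor_lift (\<lambda>vs.
    tensor_between scale (map (koszul_twist scale C p) (take r vs)) (D (vs ! r)) (drop (Suc r) vs))"

definition tensor_power_degree ::
  "('k::field \<Rightarrow> 'a::ab_group_add \<Rightarrow> 'a) \<Rightarrow> (int \<Rightarrow> 'a set) \<Rightarrow> nat \<Rightarrow> int \<Rightarrow> ('k, 'a) tensor set"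
  where "tensor_power_degree scale C k d = module.span tscale
    {pure_tensor scale vs | vs. length vs = k \<and> (\<exists>ds. list_all2 (\<lambda>v i. v \<in> C i) vs ds \<and> sum_list ds = d)}"

definition graded_coproduct ::
  "('k::field \<Rightarrow> 'a::ab_group_add \<Rightarrow> 'a) \<Rightarrow> (int \<Rightarrow> 'a set) \<Rightarrow> nat \<Rightarrow> int \<Rightarrow> ('a \<Rightarrow> ('k, 'a) tensor) \<Rightarrow> bool"
  where "graded_coproduct scale C k p D \<longleftrightarrow>
    Vector_Spaces.linear scale tscale D \<and> range D \<subseteq> tensor_power scale k \<and>
    (\<forall>i. D ` C i \<subseteq> tensor_power_degree scale C k (i + p))"


section \<open>\<open>A\<^sub>\<infinity>\<close>-coalgebras, Rota-Baxter operators and \<open>Dend\<^sub>\<infinity>\<close>-coalgebras\<close>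

text \<open>The values \<open>\<Delta> 0\<close>, and \<open>\<Delta> k r\<close> for \<open>r\<close> outside \<open>{1..k}\<close>, are irrelevant.\<close>

locale A_inf_coalgebra = graded_vector_space scale C
  for scale :: "'k::field_char_0 \<Rightarrow> 'a::ab_group_add \<Rightarrow> 'a" and C :: "int \<Rightarrow> 'a set" +
  fixes \<Delta> :: "nat \<Rightarrow> 'a \<Rightarrow> ('k, 'a) tensor"
  assumes graded: "\<And>k. k \<ge> 1 \<Longrightarrow> graded_coproduct scale C k (int k - 2) (\<Delta> k)"
    and A_inf_identity: "\<And>n x. n \<ge> 1 \<Longrightarrow>
      (\<Sum>(r, s, t) | r + s + t = n \<and> s \<ge> 1.
        tscale ((-1) ^ (r * s + t))
          (tensor_insert scale C (int s - 2) r (\<Delta> s) (\<Delta> (r + 1 + t) x))) = 0"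

locale Rota_Baxter_operator = A_inf_coalgebra scale C \<Delta>
  for scale :: "'k::field_char_0 \<Rightarrow> 'a::ab_group_add \<Rightarrow> 'a" and C :: "int \<Rightarrow> 'a set"
    and \<Delta> :: "nat \<Rightarrow> 'a \<Rightarrow> ('k, 'a) tensor" +
  fixes R :: "'a \<Rightarrow> 'a"
  assumes linear_R: "Vector_Spaces.linear scale scale R"
    and degree_R: "\<And>i. R ` C i \<subseteq> C i"
    and Rota_Baxter: "\<And>k x. k \<ge> 1 \<Longrightarrow>
      tensor_map scale (replicate k R) (\<Delta> k x) =
      (\<Sum>i\<in>{1..k}. tensor_map scale ((replicate k R)[i - 1 := id]) (\<Delta> k (R x)))"

text \<open>The label \<open>[r] \<in> C\<^sub>n\<close> is the number \<open>r \<in> {1..n}\<close>; an element of the vector space with basis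
  \<open>C\<^sub>n\<close> is a finitely supported function \<open>nat \<Rightarrow>\<^sub>0 'k\<close>.\<close>

definition R0 :: "nat \<Rightarrow> nat \<Rightarrow> nat \<Rightarrow> nat \<Rightarrow> nat"
  where "R0 m i n r = (if r \<le> i - 1 then r else if r \<le> i + n - 1 then i else r - n + 1)"

definition R1 :: "nat \<Rightarrow> nat \<Rightarrow> nat \<Rightarrow> nat \<Rightarrow> (nat \<Rightarrow>\<^sub>0 'k::field)"
  where "R1 m i n r = (if i \<le> r \<and> r \<le> i + n - 1 then Poly_Mapping.single (r - i + 1) 1
    else (\<Sum>j\<in>{1..n}. Poly_Mapping.single j 1))"

text \<open>\<open>label_extend \<Delta> k a\<close> is the coproduct \<open>\<triangle>\<^bsub>k,a\<^esub>\<close> for a linear combination \<open>a\<close> of labels in \<open>C\<^sub>k\<close>.\<close>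

definition label_extend ::
  "(nat \<Rightarrow> nat \<Rightarrow> 'a \<Rightarrow> ('k::field, 'a) tensor) \<Rightarrow> nat \<Rightarrow> (nat \<Rightarrow>\<^sub>0 'k) \<Rightarrow> 'a \<Rightarrow> ('k, 'a) tensor"
  where "label_extend \<Delta> k a x = (\<Sum>j\<in>{1..k}. tscale (Poly_Mapping.lookup a j) (\<Delta> k j x))"

locale Dend_inf_coalgebra = graded_vector_space scale C
  for scale :: "'k::field_char_0 \<Rightarrow> 'a::ab_group_add \<Rightarrow> 'a" and C :: "int \<Rightarrow> 'a set" +
  fixes \<Delta> :: "nat \<Rightarrow> nat \<Rightarrow> 'a \<Rightarrow> ('k, 'a) tensor"
  assumes graded: "\<And>k r. k \<ge> 1 \<Longrightarrow> r \<in> {1..k} \<Longrightarrow> graded_coproduct scale C k (int k - 2) (\<Delta> k r)"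
    and Dend_inf_identity: "\<And>n \<theta> x. n \<ge> 1 \<Longrightarrow> \<theta> \<in> {1..n} \<Longrightarrow>
      (\<Sum>(r, s, t) | r + s + t = n \<and> s \<ge> 1.
        tscale ((-1) ^ (r * s + t))
          (tensor_insert scale C (int s - 2) r
            (label_extend \<Delta> s (R1 (r + 1 + t) (r + 1) s \<theta>))
            (\<Delta> (r + 1 + t) (R0 (r + 1 + t) (r + 1) s \<theta>) x))) = 0"


section \<open>The universal property of tensor powers and the action on pure tensors\<close>

lemma vector_space_mult: "vector_space ((*) :: 'k::field \<Rightarrow> 'k \<Rightarrow> 'k)"
  by unfold_locales (auto simp: algebra_simps)

lemma vector_space_tscale: "vector_space (tscale :: 'k::field \<Rightarrow> ('k, 'a) tensor \<Rightarrow> ('k, 'a) tensor)"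
  by unfold_locales (auto simp: tscale_def fun_eq_iff algebra_simps)

lemma linearI:
  assumes "vector_space s1" "vector_space s2"
    and "\<And>x y. f (x + y) = f x + f y" and "\<And>c x. f (s1 c x) = s2 c (f x)"
  shows "Vector_Spaces.linear s1 s2 f"
  using assms
  by (simp add: Vector_Spaces.linear_def module_hom_def module_hom_axioms_def module_iff_vector_space)

lemma linear_addD: "Vector_Spaces.linear s1 s2 f \<Longrightarrow> f (x + y) = f x + f y"
  using module_hom.add[of s1 s2 f x y] by (simp add: Vector_Spaces.linear_def)

lemma linear_scaleD: "Vector_Spaces.linear s1 s2 f \<Longrightarrow> f (s1 c x) = s2 c (f x)"
  using module_hom.scale[of s1 s2 f c x] by (simp add: Vector_Spaces.linear_def)

lemma linear_compose':
  assumes "Vector_Spaces.linear s1 s2 f" and "Vector_Spaces.linear s2 s3 h"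
  shows "Vector_Spaces.linear s1 s3 (\<lambda>x. h (f x))"
  using Vector_Spaces.linear_compose[OF assms] by (simp add: o_def)

lemma linear_eval: "Vector_Spaces.linear tscale (*) (\<lambda>\<phi> :: ('k::field, 'a) tensor. \<phi> g)"
  by (rule linearI[OF vector_space_tscale vector_space_mult]) (auto simp: tscale_def)

lemma multilinear_compose:
  assumes "multilinear s1 s2 k F" and "Vector_Spaces.linear s2 s3 h"
  shows "multilinear s1 s3 k (\<lambda>vs. h (F vs))"
  using assms linear_compose'[OF _ assms(2)]
  by (auto simp: multilinear_def)

lemma pure_apply: "multilinear scale (*) (length vs) g \<Longrightarrow> pure_tensor scale vs g = g vs"
  by (simp add: pure_tensor_def)

lemma multilinear_pure:
  assumes "vector_space scale"
  shows "multilinear scale tscale k (pure_tensor scale)"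
proof -
  have add: "g (vs[i := x + y]) = g (vs[i := x]) + g (vs[i := y])"
    and hom: "g (vs[i := scale c x]) = c * g (vs[i := x])"
    if "multilinear scale (*) (length vs) g" "i < length vs" for g vs i x y c
  proof -
    have "Vector_Spaces.linear scale (*) (\<lambda>x. g (vs[i := x]))"
      using that by (auto simp: multilinear_def)
    then interpret l: Vector_Spaces.linear scale "(*)" "\<lambda>x. g (vs[i := x])" .
    show "g (vs[i := x + y]) = g (vs[i := x]) + g (vs[i := y])" by (rule l.add)
    show "g (vs[i := scale c x]) = c * g (vs[i := x])" by (rule l.scale)
  qed
  show ?thesis
    unfolding multilinear_def
    by (intro allI impI linearI[OF assms vector_space_tscale])
      (auto simp: pure_tensor_def fun_eq_iff tscale_def add hom)
qed

lemma tensor_lift_pure: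
  assumes "multilinear scale tscale (length vs) F"
  shows "tensor_lift F (pure_tensor scale vs) = F vs"
  using multilinear_compose[OF assms linear_eval]
  by (simp add: tensor_lift_def pure_tensor_def)

theorem tensor_power_universal_existence:
  fixes scale :: "'k::field \<Rightarrow> 'a::ab_group_add \<Rightarrow> 'a" and sW :: "'k \<Rightarrow> 'w::ab_group_add \<Rightarrow> 'w"
  assumes W: "vector_space sW" and F: "multilinear scale sW k F"
  shows "\<exists>L. Vector_Spaces.linear tscale sW L \<and> (\<forall>vs. length vs = k \<longrightarrow> L (pure_tensor scale vs) = F vs)"
proof -
  interpret P: vector_space_pair "tscale :: 'k \<Rightarrow> ('k, 'a) tensor \<Rightarrow> ('k, 'a) tensor" sW
    using W vector_space_tscale by (simp add: vector_space_pair_def)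
  interpret Q: vector_space_pair sW "(*) :: 'k \<Rightarrow> 'k \<Rightarrow> 'k"
    using W vector_space_mult by (simp add: vector_space_pair_def)
  define S where "S = {pure_tensor scale vs | vs. length vs = k}"
  obtain B where B: "B \<subseteq> S" "P.vs1.independent B" "S \<subseteq> P.vs1.span B"
    using P.vs1.maximal_independent_subset by blast
  define rep where "rep b = (SOME vs. length vs = k \<and> pure_tensor scale vs = b)" for b
  have rep: "length (rep b) = k \<and> pure_tensor scale (rep b) = b" if "b \<in> B" for b
    unfolding rep_def by (rule someI_ex) (use that B(1) S_def in blast)
  obtain L where L: "Vector_Spaces.linear tscale sW L" "\<forall>b\<in>B. L b = F (rep b)"
    using P.linear_independent_extend[OF B(2), of "\<lambda>b. F (rep b)"] by blast
  interpret L: Vector_Spaces.linear tscale sW L by fact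
  have "L (pure_tensor scale vs) = F vs" if "length vs = k" for vs
  proof (rule ccontr)
    assume ne: "L (pure_tensor scale vs) \<noteq> F vs"
    define y where "y = L (pure_tensor scale vs) - F vs"
    have "P.vs2.independent {y}" using ne by (simp add: y_def P.vs2.dependent_single)
    then obtain h where h: "Vector_Spaces.linear sW (*) h" "h y = 1"
      using Q.linear_independent_extend[of "{y}" "\<lambda>_. 1"] by auto
    interpret h: Vector_Spaces.linear sW "(*)" h by fact
    have ml: "multilinear scale (*) k (\<lambda>vs. h (F vs))" using multilinear_compose[OF F h(1)] .
    have eq: "\<phi> (\<lambda>vs. h (F vs)) = h (L \<phi>)" if "\<phi> \<in> P.vs1.span B" for \<phi>
      using that
    proof (induction rule: P.vs1.span_induct_alt)
      case base
      have "h (L 0) = 0" by (simp only: L.zero h.zero)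
      then show ?case by (simp only: zero_fun_def)
    next
      case (step c b \<phi>)
      have "b (\<lambda>vs. h (F vs)) = h (L b)"
        using pure_apply[of scale "rep b" "\<lambda>vs. h (F vs)"] ml rep[OF step(1)] L(2) step(1) by auto
      moreover have "h (L (tscale c b + \<phi>)) = c * h (L b) + h (L \<phi>)"
        by (simp only: L.add L.scale h.add h.scale)
      ultimately show ?case using step(2) by (simp only: tscale_def plus_fun_def)
    qed
    have "pure_tensor scale vs \<in> P.vs1.span B" using that B(3) S_def by blast
    from eq[OF this] have "h (F vs) = h (L (pure_tensor scale vs))"
      using pure_apply[of scale vs "\<lambda>vs. h (F vs)"] ml that by simp
    then have "h y = 0" by (simp add: y_def h.diff)
    then show False using h(2) by simp
  qed
  with L(1) show ?thesis by blast
qed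

theorem tensor_power_universal_uniqueness:
  fixes scale :: "'k::field \<Rightarrow> 'a::ab_group_add \<Rightarrow> 'a"
  assumes "Vector_Spaces.linear tscale sW L" and "Vector_Spaces.linear tscale sW L'"
    and "\<And>vs. length vs = k \<Longrightarrow> L (pure_tensor scale vs) = L' (pure_tensor scale vs)"
    and "\<phi> \<in> tensor_power scale k"
  shows "L \<phi> = L' \<phi>"
proof -
  interpret L: Vector_Spaces.linear tscale sW L by fact
  interpret P: vector_space_pair "tscale :: 'k \<Rightarrow> ('k, 'a) tensor \<Rightarrow> ('k, 'a) tensor" sW
    using L.vs2.vector_space_axioms vector_space_tscale by (simp add: vector_space_pair_def)
  show ?thesis
    using P.linear_eq_on_span[OF assms(1,2), of "{pure_tensor scale vs | vs. length vs = k}" \<phi>] assms(3,4)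
    by (auto simp: tensor_power_def)
qed

lemma tensor_map_pure:
  assumes V: "vector_space scale" and len: "length fs = length vs"
    and lin: "\<And>f. f \<in> set fs \<Longrightarrow> Vector_Spaces.linear scale scale f"
  shows "tensor_map scale fs (pure_tensor scale vs) = pure_tensor scale (map2 (\<lambda>f v. f v) fs vs)"
  unfolding tensor_map_def
proof (rule tensor_lift_pure, unfold multilinear_def, intro allI impI)
  fix us :: "'b list" and i
  assume us: "length us = length vs" and i: "i < length vs"
  have "map2 (\<lambda>f v. f v) fs (us[i := x]) = (map2 (\<lambda>f v. f v) fs us)[i := (fs ! i) x]" for x
    using us i len by (auto intro!: nth_equalityI simp: nth_list_update)
  moreover have "Vector_Spaces.linear scale tscale
      (\<lambda>x. pure_tensor scale ((map2 (\<lambda>f v. f v) fs us)[i := x]))"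
    using multilinear_pure[OF V, of "length vs"] us i len by (auto simp: multilinear_def)
  moreover have "Vector_Spaces.linear scale scale (fs ! i)" using lin i len by simp
  ultimately show "Vector_Spaces.linear scale tscale
      (\<lambda>x. pure_tensor scale (map2 (\<lambda>f v. f v) fs (us[i := x])))"
    using linear_compose'[of scale scale "fs ! i" tscale] by simp
qed

lemma tensor_between_pure:
  assumes V: "vector_space scale"
  shows "tensor_between scale us (pure_tensor scale xs) ws = pure_tensor scale (us @ xs @ ws)"
  unfolding tensor_between_def
proof (rule tensor_lift_pure, unfold multilinear_def, intro allI impI)
  fix ys :: "'b list" and i
  assume ys: "length ys = length xs" and i: "i < length xs"
  have "us @ ys[i := x] @ ws = (us @ ys @ ws)[length us + i := x]" for x
    using ys i by (simp add: list_update_append)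
  then show "Vector_Spaces.linear scale tscale (\<lambda>x. pure_tensor scale (us @ ys[i := x] @ ws))"
    using multilinear_pure[OF V, of "length (us @ ys @ ws)"] ys i
    unfolding multilinear_def by simp
qed

lemma multilinear_tensor_between:
  assumes V: "vector_space scale" and \<tau>: "\<tau> \<in> tensor_power scale s"
  shows "multilinear scale tscale (a + b) (\<lambda>vs. tensor_between scale (take a vs) \<tau> (drop a vs))"
  unfolding multilinear_def
proof (intro allI impI)
  interpret T: vector_space tscale by (rule vector_space_tscale)
  interpret V: vector_space scale by fact
  fix vs :: "'b list" and i
  assume vs: "length vs = a + b" and i: "i < a + b"
  let ?G = "\<lambda>\<tau> x. tensor_between scale (take a (vs[i := x])) \<tau> (drop a (vs[i := x]))"
  show "Vector_Spaces.linear scale tscale (?G \<tau>)"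
    using \<tau> unfolding tensor_power_def
  proof (induction rule: T.span_induct_alt)
    case base
    show ?case
      by (rule linearI[OF V vector_space_tscale])
        (simp_all add: tensor_between_def tensor_lift_def tscale_def fun_eq_iff)
  next
    case (step c p \<tau>)
    then obtain xs where p: "p = pure_tensor scale xs" by blast
    define j where "j = (if i < a then i else length xs + i)"
    have eq: "take a (vs[i := x]) @ xs @ drop a (vs[i := x]) = (take a vs @ xs @ drop a vs)[j := x]" for x
      using vs i by (cases "i < a")
        (auto simp: j_def list_update_append drop_update_swap take_update_swap list_update_beyond)
    have "j < length (take a vs @ xs @ drop a vs)" using vs i by (auto simp: j_def)
    then have l1: "Vector_Spaces.linear scale tscale (?G p)"
      unfolding p tensor_between_pure[OF V] eq
      using multilinear_pure[OF V, of "length (take a vs @ xs @ drop a vs)"]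
      unfolding multilinear_def by blast
    have "?G (tscale c p + \<tau>) = (\<lambda>x. tscale c (?G p x) + ?G \<tau> x)"
      by (simp add: tensor_between_def tensor_lift_def tscale_def fun_eq_iff)
    moreover have "Vector_Spaces.linear scale tscale (\<lambda>x. tscale c (?G p x) + ?G \<tau> x)"
    proof (rule linearI[OF V vector_space_tscale])
      fix x y d
      show "tscale c (?G p (x + y)) + ?G \<tau> (x + y) =
          tscale c (?G p x) + ?G \<tau> x + (tscale c (?G p y) + ?G \<tau> y)"
        unfolding linear_addD[OF l1] linear_addD[OF step(2)]
        by (simp only: T.scale_right_distrib ac_simps)
      show "tscale c (?G p (scale d x)) + ?G \<tau> (scale d x) =
          tscale d (tscale c (?G p x) + ?G \<tau> x)"
        unfolding linear_scaleD[OF l1] linear_scaleD[OF step(2)]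
        by (simp only: T.scale_right_distrib T.scale_scale mult.commute)
    qed
    ultimately show ?case by (simp only:)
  qed
qed

lemma linear_tensor_between: "Vector_Spaces.linear tscale tscale (\<lambda>\<tau>. tensor_between scale us \<tau> ws)"
  by (rule linearI[OF vector_space_tscale vector_space_tscale])
    (simp_all add: tensor_between_def tensor_lift_def tscale_def fun_eq_iff)

context graded_vector_space
begin

lemma component_decomposition: "decomposition C v (component C v)"
  unfolding component_def by (rule theI'[OF direct_sum])

lemma component_eq: "decomposition C v c \<Longrightarrow> component C v = c"
  using component_decomposition direct_sum by blast

lemma component_sum:
  assumes "finite A" and "{i. component C v i \<noteq> 0} \<subseteq> A"
  shows "v = (\<Sum>i\<in>A. component C v i)"
proof -
  have "v = (\<Sum>i | component C v i \<noteq> 0. component C v i)"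
    using component_decomposition by (simp add: decomposition_def)
  also have "\<dots> = (\<Sum>i\<in>A. component C v i)"
    using assms by (intro sum.mono_neutral_left) auto
  finally show ?thesis .
qed

lemma finite_component: "finite {i. component C v i \<noteq> 0}"
  using component_decomposition by (simp add: decomposition_def)

lemma component_homogeneous:
  assumes "v \<in> C i"
  shows "component C v = (\<lambda>j. if j = i then v else 0)"
proof (rule component_eq)
  have "{j. (if j = i then v else 0) \<noteq> 0} = (if v = 0 then {} else {i})" by auto
  then show "decomposition C v (\<lambda>j. if j = i then v else 0)"
    using assms subspace_C by (auto simp: decomposition_def subspace_0)
qed

lemma component_add: "component C (v + w) = (\<lambda>i. component C v i + component C w i)"
proof (rule component_eq)
  let ?A = "{i. component C v i \<noteq> 0} \<union> {i. component C w i \<noteq> 0}"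
  have f: "finite ?A" using finite_component by simp
  have sub: "{i. component C v i + component C w i \<noteq> 0} \<subseteq> ?A" by auto
  have "v + w = (\<Sum>i\<in>?A. component C v i) + (\<Sum>i\<in>?A. component C w i)"
    using component_sum[OF f, of v] component_sum[OF f, of w] by simp
  also have "\<dots> = (\<Sum>i\<in>?A. component C v i + component C w i)" by (simp add: sum.distrib)
  also have "\<dots> = (\<Sum>i | component C v i + component C w i \<noteq> 0. component C v i + component C w i)"
    using f by (intro sum.mono_neutral_right) auto
  finally show "decomposition C (v + w) (\<lambda>i. component C v i + component C w i)"
    using component_decomposition finite_subset[OF sub f] subspace_C
    by (auto simp: decomposition_def subspace_add)
qed

lemma component_scale: "component C (scale c v) = (\<lambda>i. scale c (component C v i))"
proof (rule component_eq)
  let ?A = "{i. component C v i \<noteq> 0}"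
  have sub: "{i. scale c (component C v i) \<noteq> 0} \<subseteq> ?A" by auto
  have "scale c v = (\<Sum>i\<in>?A. scale c (component C v i))"
    using component_sum[OF finite_component subset_refl, of v] by (metis scale_sum_right)
  also have "\<dots> = (\<Sum>i | scale c (component C v i) \<noteq> 0. scale c (component C v i))"
    using finite_component sub by (intro sum.mono_neutral_right) auto
  finally show "decomposition C (scale c v) (\<lambda>i. scale c (component C v i))"
    using component_decomposition finite_subset[OF sub finite_component] subspace_C
    by (auto simp: decomposition_def subspace_scale)
qed

lemma koszul_twist_homogeneous:
  assumes "v \<in> C i"
  shows "koszul_twist scale C p v = scale ((-1) powi (p * i)) v"
proof -
  have "{j. component C v j \<noteq> 0} = (if v = 0 then {} else {i})"
    by (auto simp: component_homogeneous[OF assms])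
  then show ?thesis by (simp add: koszul_twist_def component_homogeneous[OF assms])
qed

lemma koszul_twist_sum:
  assumes "finite A" and "{i. component C v i \<noteq> 0} \<subseteq> A"
  shows "koszul_twist scale C p v = (\<Sum>i\<in>A. scale ((-1) powi (p * i)) (component C v i))"
  unfolding koszul_twist_def using assms by (intro sum.mono_neutral_left) auto

lemma linear_koszul_twist: "Vector_Spaces.linear scale scale (koszul_twist scale C p)"
proof (rule linearI[OF vector_space_axioms vector_space_axioms])
  fix v w
  let ?A = "{i. component C v i \<noteq> 0} \<union> {i. component C w i \<noteq> 0}"
  have "finite ?A" using finite_component by simp
  then show "koszul_twist scale C p (v + w) = koszul_twist scale C p v + koszul_twist scale C p w"
    by (subst (1 2 3) koszul_twist_sum[of ?A])
      (auto simp: component_add scale_right_distrib sum.distrib)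
next
  fix c v
  show "koszul_twist scale C p (scale c v) = scale c (koszul_twist scale C p v)"
    by (subst (1 2) koszul_twist_sum[OF finite_component[of v]])
      (auto simp: component_scale scale_sum_right mult.commute)
qed

lemma tensor_insert_pure:
  assumes D: "Vector_Spaces.linear scale tscale D" "range D \<subseteq> tensor_power scale s"
    and len: "length us = r"
  shows "tensor_insert scale C p r D (pure_tensor scale (us @ v # ws)) =
    tensor_between scale (map (koszul_twist scale C p) us) (D v) ws"
proof -
  let ?k = "koszul_twist scale C p"
  let ?F = "\<lambda>vs. tensor_between scale (map ?k (take r vs)) (D (vs ! r)) (drop (Suc r) vs)"
  have "multilinear scale tscale (length (us @ v # ws)) ?F"
    unfolding multilinear_def
  proof (intro allI impI)
    fix vs :: "'a list" and i
    assume vs: "length vs = length (us @ v # ws)" and i: "i < length (us @ v # ws)"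
    let ?xs = "map ?k (take r vs) @ drop (Suc r) vs"
    have lx: "length ?xs = r + length ws" using vs len by simp
    have M: "Vector_Spaces.linear scale tscale (\<lambda>x. tensor_between scale
        (take r (?xs[j := x])) (D (vs ! r)) (drop r (?xs[j := x])))" if "j < r + length ws" for j
      using multilinear_tensor_between[OF vector_space_axioms, of "D (vs ! r)" s r "length ws"] D(2) lx that
      unfolding multilinear_def by blast
    have lr: "length (map ?k (take r vs)) = r" using vs len by simp
    consider "i < r" | "i = r" | "i > r" by linarith
    then show "Vector_Spaces.linear scale tscale (\<lambda>x. ?F (vs[i := x]))"
    proof cases
      case 1
      have "?F (vs[i := x]) = tensor_between scale
        (take r (?xs[i := ?k x])) (D (vs ! r)) (drop r (?xs[i := ?k x]))" for x
        using 1 lr by (simp add: list_update_append take_update_swap map_update)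
      then show ?thesis using linear_compose'[OF linear_koszul_twist M[of i]] 1 by simp
    next
      case 2
      then have "?F (vs[i := x]) = tensor_between scale (map ?k (take r vs)) (D x) (drop (Suc r) vs)" for x
        using vs len by simp
      then show ?thesis using linear_compose'[OF D(1) linear_tensor_between] by simp
    next
      case 3
      then have "?F (vs[i := x]) = tensor_between scale
        (take r (?xs[i - 1 := x])) (D (vs ! r)) (drop r (?xs[i - 1 := x]))" for x
        using lr by (auto simp add: list_update_append drop_update_swap)
      then show ?thesis using M[of "i - 1"] 3 i len by simp
    qed
  qed
  from tensor_lift_pure[OF this] show ?thesis
    using len by (simp add: tensor_insert_def nth_append)
qed

theorem tensor_insert_homogeneous:
  assumes D: "Vector_Spaces.linear scale tscale D" "range D \<subseteq> tensor_power scale s"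
    and hom: "list_all2 (\<lambda>v i. v \<in> C i) us ds" and len: "length us = r"
  shows "tensor_insert scale C p r D (pure_tensor scale (us @ v # ws)) =
    tscale ((-1) powi (p * sum_list ds)) (tensor_between scale us (D v) ws)"
proof -
  interpret T: vector_space "tscale :: 'k \<Rightarrow> ('k, 'a) tensor \<Rightarrow> ('k, 'a) tensor" by (rule vector_space_tscale)
  have "tensor_between scale (zs @ map (koszul_twist scale C p) us) \<tau> ws =
      tscale ((-1) powi (p * sum_list ds)) (tensor_between scale (zs @ us) \<tau> ws)"
    if \<tau>: "\<tau> \<in> tensor_power scale s" for \<tau> zs
    using hom
  proof (induction arbitrary: zs rule: list_all2_induct)
    case Nil
    then show ?case by simp
  next
    case (Cons u us d ds)
    let ?c = "(-1) powi (p * d) :: 'k"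
    let ?k = "koszul_twist scale C p"
    have "Vector_Spaces.linear scale tscale (\<lambda>x. tensor_between scale (zs @ x # us) \<tau> ws)"
    proof -
      have "Vector_Spaces.linear scale tscale
         (\<lambda>x. tensor_between scale (take (length (zs @ u # us)) ((zs @ u # us @ ws)[length zs := x])) \<tau>
            (drop (length (zs @ u # us)) ((zs @ u # us @ ws)[length zs := x])))"
        using multilinear_tensor_between[OF vector_space_axioms \<tau>,
            of "length (zs @ u # us)" "length ws"]
        unfolding multilinear_def
        by (elim allE[of _ "zs @ u # us @ ws"] impE allE[of _ "length zs"]) simp_all
      then show ?thesis by simp
    qed
    then have sc: "tensor_between scale (zs @ scale ?c u # us) \<tau> ws =
        tscale ?c (tensor_between scale (zs @ u # us) \<tau> ws)"
      by (rule linear_scaleD)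
    have "tensor_between scale (zs @ map ?k (u # us)) \<tau> ws =
        tensor_between scale ((zs @ [scale ?c u]) @ map ?k us) \<tau> ws"
      using koszul_twist_homogeneous[OF Cons(1)] by simp
    also have "\<dots> = tscale ((-1) powi (p * sum_list ds))
        (tensor_between scale ((zs @ [scale ?c u]) @ us) \<tau> ws)"
      by (rule Cons(3))
    finally show ?case
      using sc by (simp add: power_int_add distrib_left mult.commute)
  qed
  from this[of "D v" "[]"] show ?thesis
    using tensor_insert_pure[OF D len] D(2) by (simp add: image_subset_iff)
qed

end

end

theory Submission
  imports Defs
begin

text \<open>
  Write \<open>T\<^sub>\<theta>\<close> for \<open>R \<otimes> \<dots> \<otimes> id \<otimes> \<dots> \<otimes> R\<close> with \<open>id\<close> in place \<open>\<theta>\<close> of \<open>n\<close>. The \<open>Dend\<^sub>\<infinity>\<close>-identity with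
  label \<open>\<theta>\<close> is the image under \<open>T\<^sub>\<theta>\<close> of the \<open>A\<^sub>\<infinity>\<close>-identity with the same \<open>n\<close>, term by term. To see this,
  cut the \<open>n\<close> factors of \<open>T\<^sub>\<theta>\<close> into the first \<open>r\<close>, the \<open>s\<close> factors that meet \<open>\<triangle>\<^sub>s\<close>, and the last \<open>t\<close>,
  and move \<open>T\<^sub>\<theta>\<close> to the right past \<open>id\<^bsup>\<otimes>r\<^esup> \<otimes> \<triangle>\<^sub>s \<otimes> id\<^bsup>\<otimes>t\<^esup>\<close> (lemma \<open>tensor_map_tensor_insert\<close>; no sign
  arises, because \<open>R\<close> has degree \<open>0\<close> and so commutes with the Koszul twists).

  If \<open>\<theta>\<close> lies in the middle block, the middle factors turn \<open>\<triangle>\<^sub>s\<close> into \<open>\<triangle>\<^bsub>s,[\<theta>-r]\<^esub>\<close>, and what remains on the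
  right has \<open>id\<close> in place \<open>r + 1\<close>. Otherwise the middle factors are all \<open>R\<close>, and the Rota-Baxter identity
  \<open>R\<^bsup>\<otimes>s\<^esup> \<circ> \<triangle>\<^sub>s = (\<Sum>j. \<triangle>\<^bsub>s,[j]\<^esub>) \<circ> R\<close> releases one \<open>R\<close> to the right. In both cases the two labels that
  occur are exactly \<open>R\<^sub>1[\<theta>]\<close> and \<open>R\<^sub>0[\<theta>]\<close> (lemma \<open>tensor_map_A_inf_summand\<close>).
\<close>

section \<open>Linear maps on tensor powers\<close>

lemma linear_tensor_map: "Vector_Spaces.linear tscale tscale (tensor_map scale fs)"
  by (rule linearI[OF vector_space_tscale vector_space_tscale])
    (simp_all add: tensor_map_def tensor_lift_def tscale_def fun_eq_iff)

lemma linear_tensor_insert: "Vector_Spaces.linear tscale tscale (tensor_insert scale C p r D)"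
  by (rule linearI[OF vector_space_tscale vector_space_tscale])
    (simp_all add: tensor_insert_def tensor_lift_def tscale_def fun_eq_iff)

lemma linear_image_span_subset:
  fixes L :: "('k::field, 'a) tensor \<Rightarrow> ('k, 'b) tensor"
  assumes "Vector_Spaces.linear tscale tscale L" and "L ` S \<subseteq> T"
  shows "L ` module.span tscale S \<subseteq> module.span tscale T"
proof -
  interpret L: Vector_Spaces.linear tscale tscale L by fact
  show ?thesis
    using L.vs2.span_mono[OF assms(2)] by (simp add: L.span_image)
qed

lemma tensor_map_tensor_power:
  fixes scale :: "'k::field \<Rightarrow> 'b::ab_group_add \<Rightarrow> 'b"
  assumes "vector_space scale" and "length fs = k"
    and "\<And>f. f \<in> set fs \<Longrightarrow> Vector_Spaces.linear scale scale f"
  shows "tensor_map scale fs ` tensor_power scale k \<subseteq> tensor_power scale k"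
  unfolding tensor_power_def
proof (rule linear_image_span_subset[OF linear_tensor_map], safe)
  fix vs :: "'b list" assume "k = length vs"
  then show "\<exists>ws. tensor_map scale fs (pure_tensor scale vs) = pure_tensor scale ws \<and> length ws = length vs"
    using assms by (intro exI[of _ "map2 (\<lambda>f v. f v) fs vs"]) (simp add: tensor_map_pure)
qed

lemma tensor_map_tensor_between:
  fixes scale :: "'k::field \<Rightarrow> 'b::ab_group_add \<Rightarrow> 'b"
  assumes V: "vector_space scale"
    and len: "length gs = length us" "length hs = length ws"
    and lin: "\<And>f. f \<in> set (gs @ fs @ hs) \<Longrightarrow> Vector_Spaces.linear scale scale f"
    and \<tau>: "\<tau> \<in> tensor_power scale (length fs)"
  shows "tensor_map scale (gs @ fs @ hs) (tensor_between scale us \<tau> ws) =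
    tensor_between scale (map2 (\<lambda>f v. f v) gs us) (tensor_map scale fs \<tau>) (map2 (\<lambda>f v. f v) hs ws)"
proof (rule tensor_power_universal_uniqueness[OF _ _ _ \<tau>])
  fix xs :: "'b list" assume xs: "length xs = length fs"
  show "tensor_map scale (gs @ fs @ hs) (tensor_between scale us (pure_tensor scale xs) ws) =
    tensor_between scale (map2 (\<lambda>f v. f v) gs us) (tensor_map scale fs (pure_tensor scale xs))
      (map2 (\<lambda>f v. f v) hs ws)"
    unfolding tensor_between_pure[OF V]
    by (subst (1 2) tensor_map_pure[OF V]) (use xs len lin in \<open>auto simp: tensor_between_pure[OF V]\<close>)
qed (rule linear_compose'[OF linear_tensor_between linear_tensor_map]
      linear_compose'[OF linear_tensor_map linear_tensor_between])+


section \<open>Degree zero maps and Koszul twists\<close>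

definition degree_zero_map ::
  "('k::field \<Rightarrow> 'a::ab_group_add \<Rightarrow> 'a) \<Rightarrow> (int \<Rightarrow> 'a set) \<Rightarrow> ('a \<Rightarrow> 'a) \<Rightarrow> bool"
  where "degree_zero_map scale C f \<longleftrightarrow>
    Vector_Spaces.linear scale scale f \<and> (\<forall>i. f ` C i \<subseteq> C i)"

context graded_vector_space
begin

lemma degree_zero_map_id: "degree_zero_map scale C id"
  using linear_id by (auto simp: degree_zero_map_def)

lemma component_degree_zero_map:
  assumes "degree_zero_map scale C f"
  shows "component C (f v) = (\<lambda>i. f (component C v i))"
proof (rule component_eq)
  interpret f: Vector_Spaces.linear scale scale f using assms by (simp add: degree_zero_map_def)
  let ?A = "{i. component C v i \<noteq> 0}"
  have sub: "{i. f (component C v i) \<noteq> 0} \<subseteq> ?A" by (auto simp: f.zero)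
  have "f v = (\<Sum>i\<in>?A. f (component C v i))"
    using component_sum[OF finite_component subset_refl, of v] by (metis f.sum)
  also have "\<dots> = (\<Sum>i | f (component C v i) \<noteq> 0. f (component C v i))"
    using finite_component sub by (intro sum.mono_neutral_right) auto
  finally show "decomposition C (f v) (\<lambda>i. f (component C v i))"
    using component_decomposition assms finite_subset[OF sub finite_component]
    by (auto simp: decomposition_def degree_zero_map_def image_subset_iff)
qed

text \<open>
  A map of degree \<open>0\<close> preserves the homogeneous components, and the twist is a scalar on each of them.
\<close>

lemma koszul_twist_degree_zero_map:
  assumes "degree_zero_map scale C f"
  shows "koszul_twist scale C p (f v) = f (koszul_twist scale C p v)"
proof -
  interpret f: Vector_Spaces.linear scale scale f using assms by (simp add: degree_zero_map_def)
  note comp = component_degree_zero_map[OF assms]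
  have "koszul_twist scale C p (f v) =
      (\<Sum>i | component C v i \<noteq> 0. scale ((-1) powi (p * i)) (f (component C v i)))"
    by (subst koszul_twist_sum[OF finite_component[of v]]) (auto simp: comp f.zero)
  then show ?thesis by (simp add: koszul_twist_def f.sum f.scale)
qed

lemma map2_koszul_twist:
  assumes "\<And>g. g \<in> set gs \<Longrightarrow> degree_zero_map scale C g"
  shows "map (koszul_twist scale C p) (map2 (\<lambda>f v. f v) gs us) =
    map2 (\<lambda>f v. f v) gs (map (koszul_twist scale C p) us)"
  using assms
  by (auto simp: zip_map2 koszul_twist_degree_zero_map dest: set_zip_leftD)

text \<open>
  Naturality of \<open>id\<^bsup>\<otimes>r\<^esup> \<otimes> D \<otimes> id\<^bsup>\<otimes>t\<^esup>\<close>: if \<open>(f\<^sub>1 \<otimes> \<dots> \<otimes> f\<^sub>s) \<circ> D = D' \<circ> f\<close>, then the outer factors pass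
  through without a sign, and the middle ones are exchanged for the single factor \<open>f\<close>. The middle square
  is left abstract because it is instantiated both by the definition of the labelled coproducts (with \<open>f = id\<close>)
  and by the Rota-Baxter identity (with \<open>f = R\<close>).
\<close>

lemma tensor_map_tensor_insert:
  assumes D: "Vector_Spaces.linear scale tscale D" "range D \<subseteq> tensor_power scale (length fs)"
    and D': "Vector_Spaces.linear scale tscale D'" "range D' \<subseteq> tensor_power scale (length fs)"
    and deg: "\<And>g. g \<in> set gs \<Longrightarrow> degree_zero_map scale C g"
    and lin: "\<And>g. g \<in> set (f # fs @ hs) \<Longrightarrow> Vector_Spaces.linear scale scale g"
    and square: "\<And>v. tensor_map scale fs (D v) = D' (f v)"
    and \<phi>: "\<phi> \<in> tensor_power scale (length gs + 1 + length hs)"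
  shows "tensor_map scale (gs @ fs @ hs) (tensor_insert scale C p (length gs) D \<phi>) =
    tensor_insert scale C p (length gs) D' (tensor_map scale (gs @ f # hs) \<phi>)"
proof (rule tensor_power_universal_uniqueness[OF _ _ _ \<phi>])
  note V = vector_space_axioms
  let ?app = "map2 (\<lambda>f v. f v)"
  let ?k = "map (koszul_twist scale C p)"
  have lin': "Vector_Spaces.linear scale scale g" if "g \<in> set gs \<union> set (f # fs @ hs)" for g
    using that deg lin by (auto simp: degree_zero_map_def)
  fix vs :: "'a list" assume len: "length vs = length gs + 1 + length hs"
  obtain us v ws where vs: "vs = us @ v # ws" and us: "length us = length gs"
    using id_take_nth_drop[of "length gs" vs] len by force
  then have ws: "length ws = length hs" using len by simp
  have "tensor_map scale (gs @ fs @ hs) (tensor_insert scale C p (length gs) D (pure_tensor scale vs)) =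
      tensor_map scale (gs @ fs @ hs) (tensor_between scale (?k us) (D v) ws)"
    unfolding vs by (simp only: tensor_insert_pure[OF D us])
  also have "\<dots> = tensor_between scale (?app gs (?k us)) (tensor_map scale fs (D v)) (?app hs ws)"
    by (rule tensor_map_tensor_between[OF V]) (use us ws lin' D(2) in auto)
  also have "\<dots> = tensor_between scale (?k (?app gs us)) (D' (f v)) (?app hs ws)"
    by (simp only: square map2_koszul_twist[OF deg])
  also have "\<dots> = tensor_insert scale C p (length gs) D' (pure_tensor scale (?app gs us @ f v # ?app hs ws))"
    by (subst tensor_insert_pure[OF D']) (use us in simp_all)
  also have "pure_tensor scale (?app gs us @ f v # ?app hs ws) =
      tensor_map scale (gs @ f # hs) (pure_tensor scale vs)"
    unfolding vs by (subst tensor_map_pure[OF V]) (use us ws lin' in auto)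
  finally show "tensor_map scale (gs @ fs @ hs)
      (tensor_insert scale C p (length gs) D (pure_tensor scale vs)) =
    tensor_insert scale C p (length gs) D' (tensor_map scale (gs @ f # hs) (pure_tensor scale vs))" .
qed (rule linear_compose'[OF linear_tensor_insert linear_tensor_map]
      linear_compose'[OF linear_tensor_map linear_tensor_insert])+

lemma tensor_map_tensor_power_degree:
  assumes "length fs = k" and "\<And>f. f \<in> set fs \<Longrightarrow> degree_zero_map scale C f"
  shows "tensor_map scale fs ` tensor_power_degree scale C k d \<subseteq> tensor_power_degree scale C k d"
  unfolding tensor_power_degree_def
proof (rule linear_image_span_subset[OF linear_tensor_map], safe)
  fix vs ds
  assume k: "k = length vs" and ds: "list_all2 (\<lambda>v i. v \<in> C i) vs ds"
  let ?ws = "map2 (\<lambda>f v. f v) fs vs"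
  have "list_all2 (\<lambda>v i. v \<in> C i) ?ws ds"
    using assms k ds by (force simp: list_all2_conv_all_nth degree_zero_map_def image_subset_iff)
  moreover have "tensor_map scale fs (pure_tensor scale vs) = pure_tensor scale ?ws"
    using assms k by (simp add: tensor_map_pure[OF vector_space_axioms] degree_zero_map_def)
  ultimately show "\<exists>ws. tensor_map scale fs (pure_tensor scale vs) = pure_tensor scale ws \<and>
      length ws = length vs \<and>
      (\<exists>ds'. list_all2 (\<lambda>v i. v \<in> C i) ws ds' \<and> sum_list ds' = sum_list ds)"
    using assms(1) k by (intro exI[of _ ?ws]) auto
qed

lemma graded_coproduct_tensor_map:
  assumes D: "graded_coproduct scale C k p D"
    and fs: "length fs = k" "\<And>f. f \<in> set fs \<Longrightarrow> degree_zero_map scale C f"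
  shows "graded_coproduct scale C k p (\<lambda>x. tensor_map scale fs (D x))"
proof -
  have lin: "Vector_Spaces.linear scale scale f" if "f \<in> set fs" for f
    using fs(2)[OF that] by (simp add: degree_zero_map_def)
  show ?thesis
    using D tensor_map_tensor_power[OF vector_space_axioms fs(1) lin]
      tensor_map_tensor_power_degree[OF fs]
    by (auto simp: graded_coproduct_def image_subset_iff intro: linear_compose'[OF _ linear_tensor_map])
qed

end


section \<open>Linear combinations of labels\<close>

lemma linear_label_extend:
  assumes V: "vector_space scale"
    and D: "\<And>j. j \<in> {1..k} \<Longrightarrow> Vector_Spaces.linear scale tscale (D k j)"
  shows "Vector_Spaces.linear scale tscale (label_extend D k a)"
proof -
  interpret T: vector_space tscale by (rule vector_space_tscale)
  show ?thesis
    unfolding label_extend_def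
    by (rule linearI[OF V vector_space_tscale])
      (simp_all add: linear_addD[OF D] linear_scaleD[OF D] T.scale_right_distrib sum.distrib
        T.scale_sum_right mult.commute)
qed

lemma range_label_extend:
  assumes "\<And>j. j \<in> {1..k} \<Longrightarrow> range (D k j) \<subseteq> tensor_power scale k"
  shows "range (label_extend D k a) \<subseteq> tensor_power scale k"
proof -
  interpret T: vector_space tscale by (rule vector_space_tscale)
  show ?thesis
    using assms unfolding label_extend_def tensor_power_def
    by (auto intro!: T.span_sum T.span_scale simp: image_subset_iff)
qed

lemma label_extend_single:
  assumes "j \<in> {1..k}"
  shows "label_extend D k (Poly_Mapping.single j 1) x = D k j x"
proof -
  interpret T: vector_space tscale by (rule vector_space_tscale)
  have "label_extend D k (Poly_Mapping.single j 1) x = (\<Sum>i\<in>{1..k}. if i = j then D k j x else 0)"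
    unfolding label_extend_def by (rule sum.cong) (auto simp: lookup_single)
  then show ?thesis using assms by simp
qed

lemma label_extend_sum:
  "label_extend D k (\<Sum>j\<in>{1..k}. Poly_Mapping.single j 1) x = (\<Sum>j\<in>{1..k}. D k j x)"
proof -
  interpret T: vector_space tscale by (rule vector_space_tscale)
  show ?thesis
    unfolding label_extend_def
    by (rule sum.cong) (auto simp: lookup_sum lookup_single when_def)
qed


section \<open>The \<open>Dend\<^sub>\<infinity>\<close>-coalgebra of a Rota-Baxter operator\<close>

context Rota_Baxter_operator
begin

definition split_coproduct :: "nat \<Rightarrow> nat \<Rightarrow> 'a \<Rightarrow> ('k, 'a) tensor"
  where "split_coproduct k r x = tensor_map scale ((replicate k R)[r - 1 := id]) (\<Delta> k x)"

lemma degree_zero_map_R: "degree_zero_map scale C R"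
  using linear_R degree_R by (simp add: degree_zero_map_def)

lemma degree_zero_map_factor:
  "f \<in> set ((replicate k R)[i := id]) \<Longrightarrow> degree_zero_map scale C f"
  using set_update_subset_insert[of "replicate k R" i id] degree_zero_map_R degree_zero_map_id
  by (auto split: if_splits)

lemma graded_split_coproduct:
  assumes "k \<ge> 1"
  shows "graded_coproduct scale C k (int k - 2) (split_coproduct k r)"
  unfolding split_coproduct_def
  by (rule graded_coproduct_tensor_map[OF graded[OF assms]]) (use degree_zero_map_factor in auto)

text \<open>
  The label \<open>\<theta>\<close> marks the factor \<open>id\<close> among \<open>n = r + s + t\<close> outputs. Under the composition with \<open>\<triangle>\<^sub>s\<close> in
  place \<open>r + 1\<close>, the outputs in the block \<open>r + 1, \<dots>, r + s\<close> come from that place, so \<open>R\<^sub>0\<close> records where the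
  marked output sits before \<open>\<triangle>\<^sub>s\<close> acts. Inside the block, \<open>R\<^sub>1\<close> is the position in the block; outside, it is the
  sum of all labels, as in the sum over \<open>i\<close> in the Rota-Baxter identity.
\<close>

lemma tensor_map_A_inf_summand:
  assumes s: "s \<ge> 1" and \<theta>: "\<theta> \<in> {1..r + s + t}"
  shows "tensor_map scale ((replicate (r + s + t) R)[\<theta> - 1 := id])
      (tensor_insert scale C p r (\<Delta> s) (\<Delta> (r + 1 + t) x)) =
    tensor_insert scale C p r (label_extend split_coproduct s (R1 (r + 1 + t) (r + 1) s \<theta>))
      (split_coproduct (r + 1 + t) (R0 (r + 1 + t) (r + 1) s \<theta>) x)"
proof -
  let ?D = "label_extend split_coproduct s (R1 (r + 1 + t) (r + 1) s \<theta>)"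
  have D: "Vector_Spaces.linear scale tscale (\<Delta> s)" "range (\<Delta> s) \<subseteq> tensor_power scale s"
    using graded[OF s] by (simp_all add: graded_coproduct_def)
  have D': "Vector_Spaces.linear scale tscale ?D" "range ?D \<subseteq> tensor_power scale s"
    using graded_split_coproduct[OF s]
    by (intro linear_label_extend[OF vector_space_axioms] range_label_extend;
        simp add: graded_coproduct_def)+
  have \<Delta>: "\<Delta> (r + 1 + t) x \<in> tensor_power scale (r + 1 + t)"
    using graded[of "r + 1 + t"] by (auto simp: graded_coproduct_def)
  \<comment> \<open>It remains to cut the tensor product of \<open>R\<close>'s and one \<open>id\<close> along the three blocks, and to choose the
    factor \<open>f\<close> that comes out to the right of \<open>\<triangle>\<^sub>s\<close>.\<close>
  have main: ?thesis
    if factors: "(replicate (r + s + t) R)[\<theta> - 1 := id] = gs @ fs @ hs"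
      and len: "length gs = r" "length fs = s" "length hs = t"
      and deg: "\<And>g. g \<in> set (gs @ f # fs @ hs) \<Longrightarrow> degree_zero_map scale C g"
      and square: "\<And>v. tensor_map scale fs (\<Delta> s v) = ?D (f v)"
      and rest: "gs @ f # hs = (replicate (r + 1 + t) R)[R0 (r + 1 + t) (r + 1) s \<theta> - 1 := id]"
    for gs f fs hs
  proof -
    have lin: "Vector_Spaces.linear scale scale g" if "g \<in> set (f # fs @ hs)" for g
      using deg[of g] that by (auto simp: degree_zero_map_def)
    show ?thesis
      using tensor_map_tensor_insert[of "\<Delta> s" fs ?D gs f hs "\<Delta> (r + 1 + t) x" p]
        D D' deg lin square \<Delta> len
      unfolding factors split_coproduct_def rest[symmetric] by simp
  qed
  have all_R: "tensor_map scale (replicate s R) (\<Delta> s v) = ?D (R v)" if "\<theta> \<le> r \<or> r + s < \<theta>" for v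
  proof -
    have "R1 (r + 1 + t) (r + 1) s \<theta> = (\<Sum>j\<in>{1..s}. Poly_Mapping.single j (1::'k))"
      using that by (auto simp: R1_def)
    then show ?thesis
      by (simp only: label_extend_sum split_coproduct_def Rota_Baxter[OF s])
  qed
  have blocks: "replicate (r + 1 + t) R = replicate r R @ R # replicate t R"
    using replicate_add[of r "Suc t" R] by simp
  consider "\<theta> \<le> r" | "r < \<theta>" "\<theta> \<le> r + s" | "r + s < \<theta>" by linarith
  then show ?thesis
  proof cases
    case 1
    have "\<theta> - 1 < r" using 1 \<theta> by auto
    show ?thesis
    proof (rule main[of "(replicate r R)[\<theta> - 1 := id]" "replicate s R" "replicate t R" R])
      show "(replicate (r + s + t) R)[\<theta> - 1 := id] =
          (replicate r R)[\<theta> - 1 := id] @ replicate s R @ replicate t R"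
        using 1 \<theta> by (auto simp: replicate_add list_update_append)
      show "(replicate r R)[\<theta> - 1 := id] @ R # replicate t R =
          (replicate (r + 1 + t) R)[R0 (r + 1 + t) (r + 1) s \<theta> - 1 := id]"
        unfolding blocks using 1 \<open>\<theta> - 1 < r\<close> by (simp add: R0_def list_update_append)
    qed (use 1 all_R degree_zero_map_R degree_zero_map_factor in \<open>auto split: if_splits\<close>)
  next
    case 2
    have "\<theta> - r \<in> {1..s}" using 2 by auto
    moreover have "R1 (r + 1 + t) (r + 1) s \<theta> = Poly_Mapping.single (\<theta> - r) (1::'k)"
      using 2 by (simp add: R1_def Suc_diff_Suc)
    ultimately have square: "tensor_map scale ((replicate s R)[\<theta> - r - 1 := id]) (\<Delta> s v) = ?D (id v)" for v
      by (simp only: label_extend_single split_coproduct_def id_apply)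
    show ?thesis
    proof (rule main[of "replicate r R" "(replicate s R)[\<theta> - r - 1 := id]" "replicate t R" id])
      show "(replicate (r + s + t) R)[\<theta> - 1 := id] =
          replicate r R @ (replicate s R)[\<theta> - r - 1 := id] @ replicate t R"
        using 2 by (auto simp: replicate_add list_update_append)
      show "replicate r R @ id # replicate t R =
          (replicate (r + 1 + t) R)[R0 (r + 1 + t) (r + 1) s \<theta> - 1 := id]"
        unfolding blocks using 2 by (simp add: R0_def list_update_append)
    qed (use square degree_zero_map_R degree_zero_map_id degree_zero_map_factor in
        \<open>auto split: if_splits\<close>)
  next
    case 3
    then obtain j where j: "\<theta> = r + s + 1 + j"
      using less_natE[of "r + s" \<theta>] by auto
    show ?thesis
    proof (rule main[of "replicate r R" "replicate s R" "(replicate t R)[j := id]" R])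
      show "(replicate (r + s + t) R)[\<theta> - 1 := id] =
          replicate r R @ replicate s R @ (replicate t R)[j := id]"
        using j by (auto simp: replicate_add list_update_append)
      show "replicate r R @ R # (replicate t R)[j := id] =
          (replicate (r + 1 + t) R)[R0 (r + 1 + t) (r + 1) s \<theta> - 1 := id]"
        unfolding blocks using j by (simp add: R0_def list_update_append)
    qed (use 3 all_R degree_zero_map_R degree_zero_map_factor in \<open>auto split: if_splits\<close>)
  qed
qed

lemma Dend_inf_coalgebra_split_coproduct: "Dend_inf_coalgebra scale C split_coproduct"
proof (unfold_locales)
  fix n \<theta> :: nat and x
  assume n: "n \<ge> 1" and \<theta>: "\<theta> \<in> {1..n}"
  let ?T = "tensor_map scale ((replicate n R)[\<theta> - 1 := id])"
  let ?I = "{(r, s, t). r + s + t = n \<and> s \<ge> 1}"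
  interpret T: Vector_Spaces.linear tscale tscale ?T by (rule linear_tensor_map)
  have "(\<Sum>(r, s, t)\<in>?I. tscale ((-1) ^ (r * s + t))
      (tensor_insert scale C (int s - 2) r (label_extend split_coproduct s (R1 (r + 1 + t) (r + 1) s \<theta>))
        (split_coproduct (r + 1 + t) (R0 (r + 1 + t) (r + 1) s \<theta>) x))) =
    (\<Sum>(r, s, t)\<in>?I. ?T (tscale ((-1) ^ (r * s + t))
      (tensor_insert scale C (int s - 2) r (\<Delta> s) (\<Delta> (r + 1 + t) x))))"
  proof (rule sum.cong[OF refl], clarify, goal_cases)
    case (1 r s t)
    show ?case
      unfolding linear_scaleD[OF linear_tensor_map]
      using tensor_map_A_inf_summand[of s \<theta> r t "int s - 2" x] 1 \<theta> by simp
  qed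
  also have "\<dots> = ?T (\<Sum>(r, s, t)\<in>?I. tscale ((-1) ^ (r * s + t))
      (tensor_insert scale C (int s - 2) r (\<Delta> s) (\<Delta> (r + 1 + t) x)))"
    unfolding T.sum by (rule sum.cong) auto
  also have "\<dots> = 0"
    by (simp only: A_inf_identity[OF n] T.zero)
  finally show "(\<Sum>(r, s, t)\<in>?I. tscale ((-1) ^ (r * s + t))
      (tensor_insert scale C (int s - 2) r (label_extend split_coproduct s (R1 (r + 1 + t) (r + 1) s \<theta>))
        (split_coproduct (r + 1 + t) (R0 (r + 1 + t) (r + 1) s \<theta>) x))) = 0" .
qed (rule graded_split_coproduct)

end

theorem theorem5p9:
  fixes scale :: "'k::field_char_0 \<Rightarrow> 'a::ab_group_add \<Rightarrow> 'a"
    and C :: "int \<Rightarrow> 'a set"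
    and \<Delta> :: "nat \<Rightarrow> 'a \<Rightarrow> ('k, 'a) tensor"
    and R :: "'a \<Rightarrow> 'a"
  assumes "A_inf_coalgebra scale C \<Delta>"
    and "Rota_Baxter_operator scale C \<Delta> R"
  shows "Dend_inf_coalgebra scale C
    (\<lambda>k r x. tensor_map scale ((replicate k R)[r - 1 := id]) (\<Delta> k x))"
proof -
  interpret Rota_Baxter_operator scale C \<Delta> R by fact
  show ?thesis
    using Dend_inf_coalgebra_split_coproduct unfolding split_coproduct_def[abs_def] .
qed

end
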